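(* Let $n\ge3$, $N=n(n-1)/2$. For every upper-triangular matrix $B=(b_{ij})\in\mathbb{C}^{n\times n}$ with simple eigenvalues (so that $\mu_B:=\min_{i\ne j}|b_{ii}-b_{jj}|>0$) there is a constant $c(B)>0$, depending only on $B$, such that the following holds. Let $A=(a_{ij})=B+L\in\mathbb{C}^{n\times n}$, where $L$ is strictly lower-triangular, let $\ell=\max_{i>j}|a_{ij}|=\|L\|_{\max}$, and let $A^{(N)}=(a^{(N)}_{ij})$ be the matrix obtained from $A$ after one cycle of the naive Jacobi algorithm under the row-wise pivot strategy. Let $\mu_N=\min_{i\neq j}|a^{(N)}_{ii}-a^{(N)}_{jj}|$ and $\eta_N=\max_{i\ne j}|a_{ij}^{(N)}|$. If $\ell<c(B)$, then $\mu_N>0$ and $$80(n-1)\frac{\eta_N}{\mu_N}\le 1 .$$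
   Context: All computations are in exact arithmetic. $\|M\|_{\max}$ denotes the largest modulus of an entry of $M$. Naive Jacobi step. For $A\in\mathbb{C}^{n\times n}$ and a pivot pair $(p,q)$, $1\le p<q\le n$, the step replaces $A$ by $S^{-1}T^{-1}ATS$, where $T=I+x\,e_pe_q^T$, $S=I+y\,e_qe_p^T$ ($e_i$ standard basis vectors) and $x,y\in\mathbb{C}$ are chosen as follows. (1) If $a_{pq}=a_{qp}=0$, or if $a_{pq}a_{qp}=0$ and $a_{pp}=a_{qq}$, the pair is skipped: $x=y=0$. (2) If $a_{pq}\ne0$ and $a_{qp}\neq 0$: let $d=a_{qq}-a_{pp}$ and $s=\sqrt{d^2+4a_{qp}a_{pq}}$ (a fixed choice of complex square root, e.g. principal). If $s=0$ the pair is skipped ($x=y=0$). Otherwise let $\sigma=1$ if $|d+s|>|d-s|$ and $\sigma=-1$ otherwise, and put $x=\frac{2a_{pq}}{d+\sigma s}$, $y=-\sigma\frac{a_{qp}}{s}$. (Thus $x$ is a root of smaller modulus of $a_{qp}x^2+(a_{qq}-a_{pp})x-a_{pq}=0$.) (3) If $a_{pq}\neq0$, $a_{qp}=0$, $a_{pp}\ne a_{qq}$: $x=\frac{a_{pq}}{a_{qq}-a_{pp}}$, $y=0$. (4) If $a_{pq}=0$, $a_{qp}\ne0$, $a_{pp}\neq a_{qq}$: $x=0$, $y=\frac{a_{qp}}{a_{pp}-a_{qq}}$. When the pair is not skipped, the step makes the entries at $(p,q)$ and $(q,p)$ zero. Naive Jacobi algorithm. Given pivot pairs $(p_k,q_k)$,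 $k\ge0$, set $A^{(0)}=A$ and let $A^{(k+1)}$ be the result of the naive Jacobi step applied to $A^{(k)}$ with pivot pair $(p_k,q_k)$. The row-wise pivot strategy takes the $N=n(n-1)/2$ pivot pairs in the order $(1,2),(1,3),\ldots,(1,n),(2,3),\ldots,(2,n),\ldots,(n-1,n)$ and repeats this order periodically; one pass through all $N$ pairs is one cycle. *)

theory Defs
  imports Complex_Main "Jordan_Normal_Form.Char_Poly"
begin

text \<open>
  Matrices are those of \<open>Jordan_Normal_Form\<close>, so rows and columns are indexed by
  \<open>0, ..., n - 1\<close> instead of \<open>1, ..., n\<close>. The matrix \<open>addrow_mat n x p q\<close> is
  \<open>I + x e\<^sub>p e\<^sub>q\<^sup>T\<close>.
\<close>

definition sqrt_choice :: "(complex \<Rightarrow> complex) \<Rightarrow> bool" where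
  "sqrt_choice sq \<longleftrightarrow> (\<forall>z. (sq z)\<^sup>2 = z)"

text \<open>The pair \<open>(x, y)\<close> of the step; it is \<open>(0, 0)\<close> when the pivot pair is skipped.\<close>

definition jacobi_params ::
    "(complex \<Rightarrow> complex) \<Rightarrow> complex mat \<Rightarrow> nat \<Rightarrow> nat \<Rightarrow> complex \<times> complex" where
  "jacobi_params sq A p q =
    (let app = A $$ (p,p); aqq = A $$ (q,q); apq = A $$ (p,q); aqp = A $$ (q,p) in
     if (apq = 0 \<and> aqp = 0) \<or> (apq * aqp = 0 \<and> app = aqq) then (0, 0)
     else if apq \<noteq> 0 \<and> aqp \<noteq> 0 then
       (let d = aqq - app;
            s = sq (d\<^sup>2 + 4 * aqp * apq);
            \<sigma> = (if cmod (d + s) > cmod (d - s) then 1 else - 1)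
        in if s = 0 then (0, 0)
           else (2 * apq / (d + \<sigma> * s), - \<sigma> * (aqp / s)))
     else if apq \<noteq> 0 then (apq / (aqq - app), 0)
     else (0, aqp / (app - aqq)))"

text \<open>The step forms \<open>S\<^sup>-\<^sup>1 T\<^sup>-\<^sup>1 A T S\<close>; the inverses are obtained by negating the
  parameter.\<close>

lemma addrow_mat_inverts:
  fixes x :: complex
  assumes "p \<noteq> q" "p < n" "q < n"
  shows "inverts_mat (addrow_mat n x p q) (addrow_mat n (- x) p q)"
    and "inverts_mat (addrow_mat n (- x) p q) (addrow_mat n x p q)"
  using addrow_mat_inv[OF assms(2,3,1), of x] addrow_mat_inv[OF assms(2,3,1), of "- x"]
  by (simp_all add: inverts_mat_def)

definition jacobi_step ::
    "(complex \<Rightarrow> complex) \<Rightarrow> complex mat \<Rightarrow> nat \<times> nat \<Rightarrow> complex mat" where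
  "jacobi_step sq A pq =
    (let n = dim_row A; (p, q) = pq; (x, y) = jacobi_params sq A p q
     in addrow_mat n (- y) q p * addrow_mat n (- x) p q * A
          * addrow_mat n x p q * addrow_mat n y q p)"

primrec naive_jacobi ::
    "(complex \<Rightarrow> complex) \<Rightarrow> (nat \<Rightarrow> nat \<times> nat) \<Rightarrow> complex mat \<Rightarrow> nat \<Rightarrow> complex mat" where
  "naive_jacobi sq piv A 0 = A"
| "naive_jacobi sq piv A (Suc k) = jacobi_step sq (naive_jacobi sq piv A k) (piv k)"

definition rowwise_pairs :: "nat \<Rightarrow> (nat \<times> nat) list" where
  "rowwise_pairs n = [(p, q). p \<leftarrow> [0..<n], q \<leftarrow> [Suc p..<n]]"

definition rowwise_pivots :: "nat \<Rightarrow> nat \<Rightarrow> nat \<times> nat" where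
  "rowwise_pivots n k = rowwise_pairs n ! (k mod (n * (n - 1) div 2))"

definition strictly_lower_triangular :: "'a::zero mat \<Rightarrow> bool" where
  "strictly_lower_triangular A \<longleftrightarrow>
    (\<forall>i < dim_row A. \<forall>j < dim_col A. i \<le> j \<longrightarrow> A $$ (i,j) = 0)"

definition simple_eigenvalues :: "complex mat \<Rightarrow> bool" where
  "simple_eigenvalues A \<longleftrightarrow> (\<forall>e. eigenvalue A e \<longrightarrow> Polynomial.order e (char_poly A) = 1)"

text \<open>The following three are meaningful for square matrices of size at least 2, where the
  sets are nonempty.\<close>

definition lower_max :: "complex mat \<Rightarrow> real" where
  "lower_max A = Max {cmod (A $$ (i,j)) | i j. i < dim_row A \<and> j < i}"

definition offdiag_max :: "complex mat \<Rightarrow> real" where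
  "offdiag_max A = Max {cmod (A $$ (i,j)) | i j. i < dim_row A \<and> j < dim_row A \<and> i \<noteq> j}"

definition diag_gap :: "complex mat \<Rightarrow> real" where
  "diag_gap A =
    Min {cmod (A $$ (i,i) - A $$ (j,j)) | i j. i < dim_row A \<and> j < dim_row A \<and> i \<noteq> j}"

end

theory Submission
  imports Defs
begin

text \<open>
  On an upper triangular matrix with distinct diagonal entries, each step of the cycle falls into
  case (3) (or is trivial), keeps the matrix upper triangular with the same diagonal, and in
  row-wise order never refills a position that was already annihilated; so one cycle started at
  \<open>B\<close> produces the diagonal part of \<open>B\<close>. The parameters \<open>(x, y)\<close> are continuous at every
  matrix with \<open>a\<^sub>q\<^sub>p = 0\<close> and \<open>a\<^sub>p\<^sub>p \<noteq> a\<^sub>q\<^sub>q\<close>, uniformly in the choice of square root, because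
  the sign \<open>\<sigma>\<close> forces \<open>\<sigma>s\<close> to be near \<open>d\<close>. Hence for \<open>L \<rightarrow> 0\<close> the matrix after one cycle
  tends to the diagonal part of \<open>B\<close>, where the off-diagonal entries vanish and the gap is
  \<open>\<mu>\<^sub>B > 0\<close>.
\<close>

section \<open>Entrywise limits of matrices\<close>

text \<open>The carrier condition is imposed at every index rather than eventually, so products can
  be expanded entrywise without a filter argument.\<close>

definition mat_tendsto :: "nat \<Rightarrow> ('k \<Rightarrow> complex mat) \<Rightarrow> complex mat \<Rightarrow> 'k filter \<Rightarrow> bool" where
  "mat_tendsto n X A F \<longleftrightarrow> (\<forall>k. X k \<in> carrier_mat n n) \<and> A \<in> carrier_mat n n \<and>
    (\<forall>i<n. \<forall>j<n. ((\<lambda>k. X k $$ (i,j)) \<longlongrightarrow> A $$ (i,j)) F)"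

lemma mat_tendsto_mult:
  assumes "mat_tendsto n X A F" "mat_tendsto n Y B F"
  shows "mat_tendsto n (\<lambda>k. X k * Y k) (A * B) F"
proof -
  have C: "X k \<in> carrier_mat n n" "Y k \<in> carrier_mat n n" "A \<in> carrier_mat n n"
    "B \<in> carrier_mat n n" for k
    using assms by (auto simp: mat_tendsto_def)
  have index: "(M * M') $$ (i,j) = (\<Sum>l<n. M $$ (i,l) * M' $$ (l,j))"
    if "M \<in> carrier_mat n n" "M' \<in> carrier_mat n n" "i < n" "j < n"
    for M M' :: "complex mat" and i j
    using that by (simp add: scalar_prod_def atLeast0LessThan)
  have "((\<lambda>k. \<Sum>l<n. X k $$ (i,l) * Y k $$ (l,j)) \<longlongrightarrow> (\<Sum>l<n. A $$ (i,l) * B $$ (l,j))) F"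
    if "i < n" "j < n" for i j
    using assms that by (intro tendsto_sum tendsto_mult) (auto simp: mat_tendsto_def)
  then show ?thesis
    unfolding mat_tendsto_def
    by (auto simp: index[OF C(1,2)] index[OF C(3,4)] C intro!: mult_carrier_mat[OF C(1,2)]
        mult_carrier_mat[OF C(3,4)] simp del: index_mult_mat(1))
qed

lemma mat_tendsto_addrow_mat:
  assumes "(x \<longlongrightarrow> a) F"
  shows "mat_tendsto n (\<lambda>k. addrow_mat n (x k) p q) (addrow_mat n a p q) F"
  using assms unfolding mat_tendsto_def
  by (auto simp: addrow_mat_def intro!: tendsto_intros)

section \<open>Continuity of the Jacobi step\<close>

text \<open>The number \<open>r\<close> is \<open>\<sigma>s\<close> in case (2) and \<open>d\<close> in all other cases.\<close>

lemma jacobi_params_near_triangular: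
  assumes sq: "sqrt_choice sq"
    and d: "d = A $$ (q,q) - A $$ (p,p)" "d \<noteq> 0"
    and small: "cmod (4 * A $$ (q,p) * A $$ (p,q)) < (cmod d)\<^sup>2"
  obtains r where "jacobi_params sq A p q = (2 * A $$ (p,q) / (d + r), - (A $$ (q,p) / r))"
    and "cmod (d - r) * cmod d \<le> cmod (4 * A $$ (q,p) * A $$ (p,q))"
proof (cases "A $$ (p,q) \<noteq> 0 \<and> A $$ (q,p) \<noteq> 0")
  case True
  define w where "w = 4 * A $$ (q,p) * A $$ (p,q)"
  define s where "s = sq (d\<^sup>2 + w)"
  define \<sigma> :: complex where "\<sigma> = (if cmod (d + s) > cmod (d - s) then 1 else - 1)"
  have \<sigma>2: "\<sigma> * \<sigma> = 1" by (simp add: \<sigma>_def)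
  have s2: "s * s = d\<^sup>2 + w"
    using sq by (simp add: s_def sqrt_choice_def flip: power2_eq_square)
  \<comment> \<open>Vanishing of \<open>s\<close> would force |w| = |d|^2, which
    \<open>small\<close> excludes; so the pair is not skipped.\<close>
  have "s \<noteq> 0"
  proof
    assume "s = 0"
    then have "w = - d\<^sup>2" using s2 by (metis add.inverse_unique mult_zero_left)
    then have "cmod w = (cmod d)\<^sup>2" by (simp add: norm_power)
    then show False using small by (simp add: w_def)
  qed
  have "(d - \<sigma> * s) * (d + \<sigma> * s) = d * d - (\<sigma> * \<sigma>) * (s * s)"
    by (simp add: algebra_simps)
  also have "\<dots> = - w" by (simp add: \<sigma>2 s2 power2_eq_square)
  finally have "cmod (d - \<sigma> * s) * cmod (d + \<sigma> * s) = cmod w"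
    by (metis norm_minus_cancel norm_mult)
  \<comment> \<open>The sign selects the larger of |d + s| and |d - s|, and these two numbers sum to
    at least 2|d|.\<close>
  moreover have "cmod d \<le> cmod (d + \<sigma> * s)"
  proof -
    have "2 * d = (d + s) + (d - s)" by simp
    then have "2 * cmod d \<le> cmod (d + s) + cmod (d - s)"
      by (metis norm_mult norm_numeral norm_triangle_ineq)
    then show ?thesis by (auto simp: \<sigma>_def)
  qed
  ultimately have "cmod (d - \<sigma> * s) * cmod d \<le> cmod w"
    by (metis mult_left_mono norm_ge_zero)
  moreover have "jacobi_params sq A p q
      = (2 * A $$ (p,q) / (d + \<sigma> * s), - (A $$ (q,p) / (\<sigma> * s)))"
    using True \<open>s \<noteq> 0\<close>
    unfolding jacobi_params_def Let_def d(1)[symmetric] w_def[symmetric] s_def[symmetric]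
      \<sigma>_def[symmetric]
    by (simp add: \<sigma>_def)
  ultimately show ?thesis using that[of "\<sigma> * s"] by (simp add: w_def)
next
  case False
  have neg: "A $$ (p,p) - A $$ (q,q) = - d" using d(1) by simp
  have "A $$ (p,p) \<noteq> A $$ (q,q)" using d by auto
  \<comment> \<open>With r = d one formula covers the trivial case and cases (3) and (4): a
    vanishing entry gives a vanishing parameter.\<close>
  then have "jacobi_params sq A p q = (2 * A $$ (p,q) / (d + d), - (A $$ (q,p) / d))"
    using False by (auto simp: jacobi_params_def Let_def neg simp flip: d(1) mult_2)
  then show ?thesis using that[of d] by simp
qed

text \<open>This is the step of case (3), where S is the identity; a zero entry at
  \<open>(p,q)\<close> gives x = 0 and hence the identity map.\<close>

definition triangular_step :: "nat \<Rightarrow> complex mat \<Rightarrow> nat \<times> nat \<Rightarrow> complex mat" where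
  "triangular_step n A = (\<lambda>(p, q). let x = A $$ (p,q) / (A $$ (q,q) - A $$ (p,p))
    in addrow_mat n (- x) p q * A * addrow_mat n x p q)"

text \<open>The root may vary with \<open>k\<close> and need not be continuous: the bound |d - r|
  |d| \<le> |w| with w tending to 0 forces r to the limit of d, which is nonzero.\<close>

lemma jacobi_params_tendsto:
  fixes X :: "'k \<Rightarrow> complex mat"
  assumes sq: "\<And>k. sqrt_choice (sq k)"
    and X: "mat_tendsto n X A F" and pq: "p < n" "q < n"
    and A: "A $$ (q,p) = 0" "A $$ (p,p) \<noteq> A $$ (q,q)"
  shows "((\<lambda>k. fst (jacobi_params (sq k) (X k) p q))
      \<longlongrightarrow> A $$ (p,q) / (A $$ (q,q) - A $$ (p,p))) F"
    and "((\<lambda>k. snd (jacobi_params (sq k) (X k) p q)) \<longlongrightarrow> 0) F"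
proof -
  define d where "d k = X k $$ (q,q) - X k $$ (p,p)" for k
  define w where "w k = 4 * X k $$ (q,p) * X k $$ (p,q)" for k
  define d0 where "d0 = A $$ (q,q) - A $$ (p,p)"
  have d0: "d0 \<noteq> 0" using A by (simp add: d0_def)
  have lim: "((\<lambda>k. X k $$ (i,j)) \<longlongrightarrow> A $$ (i,j)) F" if "i < n" "j < n" for i j
    using X that by (auto simp: mat_tendsto_def)
  have limd: "(d \<longlongrightarrow> d0) F"
    unfolding d_def d0_def by (intro tendsto_intros lim pq)
  have "(w \<longlongrightarrow> 4 * A $$ (q,p) * A $$ (p,q)) F"
    unfolding w_def by (intro tendsto_intros lim pq)
  then have limw: "(w \<longlongrightarrow> 0) F" using A by simp
  define good where "good k \<longleftrightarrow> d k \<noteq> 0 \<and> cmod (w k) < (cmod (d k))\<^sup>2" for k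
  have "((\<lambda>k. (cmod (d k))\<^sup>2 - cmod (w k)) \<longlongrightarrow> (cmod d0)\<^sup>2 - cmod 0) F"
    by (intro tendsto_intros limd limw)
  then have "eventually (\<lambda>k. (cmod (d k))\<^sup>2 - cmod (w k) > 0) F"
    by (rule order_tendstoD) (use d0 in simp)
  \<comment> \<open>Positivity of |d|^2 - |w| also excludes d = 0.\<close>
  then have good: "eventually good F"
    by eventually_elim (auto simp: good_def)
  \<comment> \<open>The implication is kept under the quantifier so that a single function
    \<open>r\<close> can be chosen for all \<open>k\<close>.\<close>
  have "\<exists>r. good k \<longrightarrow>
      jacobi_params (sq k) (X k) p q = (2 * X k $$ (p,q) / (d k + r), - (X k $$ (q,p) / r)) \<and>
      cmod (d k - r) * cmod (d k) \<le> cmod (w k)" for k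
    using jacobi_params_near_triangular[OF sq d_def, of k]
    unfolding good_def w_def by metis
  then obtain r where r: "\<And>k. good k \<Longrightarrow>
      jacobi_params (sq k) (X k) p q
        = (2 * X k $$ (p,q) / (d k + r k), - (X k $$ (q,p) / r k))"
    and rd: "\<And>k. good k \<Longrightarrow> cmod (d k - r k) * cmod (d k) \<le> cmod (w k)"
    by metis
  have "((\<lambda>k. cmod (w k) / cmod (d k)) \<longlongrightarrow> cmod 0 / cmod d0) F"
    by (intro tendsto_intros limd limw) (use d0 in simp)
  then have "((\<lambda>k. cmod (w k) / cmod (d k)) \<longlongrightarrow> 0) F" by simp
  moreover have "eventually (\<lambda>k. cmod (d k - r k) \<le> norm (cmod (w k) / cmod (d k)) * 1) F"
    using good by eventually_elim (use rd in \<open>auto simp: good_def field_simps\<close>)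
  ultimately have "((\<lambda>k. d k - r k) \<longlongrightarrow> 0) F"
    by (rule tendsto_0_le)
  then have "((\<lambda>k. d k - (d k - r k)) \<longlongrightarrow> d0 - 0) F"
    by (intro tendsto_diff limd)
  then have limr: "(r \<longlongrightarrow> d0) F" by simp
  have "((\<lambda>k. 2 * X k $$ (p,q) / (d k + r k)) \<longlongrightarrow> 2 * A $$ (p,q) / (d0 + d0)) F"
    by (intro tendsto_intros lim pq limd limr) (use d0 in \<open>simp flip: mult_2\<close>)
  then have "((\<lambda>k. 2 * X k $$ (p,q) / (d k + r k)) \<longlongrightarrow> A $$ (p,q) / d0) F"
    using d0 by (simp flip: mult_2)
  then show "((\<lambda>k. fst (jacobi_params (sq k) (X k) p q))
      \<longlongrightarrow> A $$ (p,q) / (A $$ (q,q) - A $$ (p,p))) F"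
    unfolding d0_def[symmetric]
    by (rule Lim_transform_eventually) (use good in eventually_elim, simp add: r)
  have "((\<lambda>k. - (X k $$ (q,p) / r k)) \<longlongrightarrow> - (A $$ (q,p) / d0)) F"
    by (intro tendsto_intros lim pq limr d0)
  then have "((\<lambda>k. - (X k $$ (q,p) / r k)) \<longlongrightarrow> 0) F" using A by simp
  then show "((\<lambda>k. snd (jacobi_params (sq k) (X k) p q)) \<longlongrightarrow> 0) F"
    by (rule Lim_transform_eventually) (use good in eventually_elim, simp add: r)
qed

lemma addrow_mat_0: "addrow_mat n 0 p q = (1\<^sub>m n :: 'a :: semiring_1 mat)"
  by (rule eq_matI) (auto simp: addrow_mat_def)

text \<open>Since y tends to 0, both factors built from \<open>y\<close> tend to the identity, and
  only the conjugation by T survives in the limit.\<close>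

lemma jacobi_step_tendsto:
  assumes "\<And>k. sqrt_choice (sq k)" "mat_tendsto n X A F" "p < n" "q < n"
    and "A $$ (q,p) = 0" "A $$ (p,p) \<noteq> A $$ (q,q)"
  shows "mat_tendsto n (\<lambda>k. jacobi_step (sq k) (X k) (p,q)) (triangular_step n A (p,q)) F"
proof -
  define x where "x k = fst (jacobi_params (sq k) (X k) p q)" for k
  define y where "y k = snd (jacobi_params (sq k) (X k) p q)" for k
  define a where "a = A $$ (p,q) / (A $$ (q,q) - A $$ (p,p))"
  have x: "(x \<longlongrightarrow> a) F" and y: "(y \<longlongrightarrow> 0) F"
    unfolding x_def y_def a_def using jacobi_params_tendsto[of sq n X A F p q] assms by auto
  have y': "((\<lambda>k. - y k) \<longlongrightarrow> 0) F" using tendsto_minus[OF y] by simp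
  have "mat_tendsto n
      (\<lambda>k. addrow_mat n (- y k) q p * addrow_mat n (- x k) p q * X k
        * addrow_mat n (x k) p q * addrow_mat n (y k) q p)
      (addrow_mat n 0 q p * addrow_mat n (- a) p q * A * addrow_mat n a p q * addrow_mat n 0 q p) F"
    by (intro mat_tendsto_mult mat_tendsto_addrow_mat tendsto_minus x y y' assms)
  moreover have "jacobi_step (sq k) (X k) (p,q) =
      addrow_mat n (- y k) q p * addrow_mat n (- x k) p q * X k
        * addrow_mat n (x k) p q * addrow_mat n (y k) q p" for k
    using assms(2)
    by (auto simp: jacobi_step_def x_def y_def mat_tendsto_def Let_def split: prod.splits)
  moreover have "addrow_mat n 0 q p * addrow_mat n (- a) p q * A * addrow_mat n a p q
        * addrow_mat n 0 q p = triangular_step n A (p,q)"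
  proof -
    have "A \<in> carrier_mat n n" using assms(2) by (simp add: mat_tendsto_def)
    then show ?thesis
      by (simp add: addrow_mat_0 triangular_step_def Let_def flip: a_def)
  qed
  ultimately show ?thesis by simp
qed

section \<open>One cycle on an upper triangular matrix\<close>

lemma triangular_step_carrier:
  "A \<in> carrier_mat n n \<Longrightarrow> triangular_step n A pq \<in> carrier_mat n n"
  by (auto simp: triangular_step_def Let_def split: prod.split)

text \<open>Row \<open>p\<close> loses x times row \<open>q\<close>, then column \<open>q\<close>
  gains x times column \<open>p\<close>. The cross term -x^2 times the entry at \<open>(q,p)\<close>
  drops out because that entry is 0.\<close>

lemma index_triangular_step:
  assumes A: "A \<in> carrier_mat n n" and "p < n" "q < n" "p \<noteq> q" "i < n" "j < n"
    and "A $$ (q,p) = 0"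
  shows "triangular_step n A (p,q) $$ (i,j) =
    (let x = A $$ (p,q) / (A $$ (q,q) - A $$ (p,p))
     in A $$ (i,j) - (if i = p then x * A $$ (q,j) else 0) + (if j = q then x * A $$ (i,p) else 0))"
proof -
  define x where "x = A $$ (p,q) / (A $$ (q,q) - A $$ (p,p))"
  have "triangular_step n A (p,q) = addcol x q p (addrow (- x) p q A)"
    using addrow_mat[OF A \<open>q < n\<close>, of "- x" p] A
      addcol_mat[of "addrow (- x) p q A" n n p x q] assms(2)
      mult_carrier_mat[OF addrow_mat_carrier A]
    by (simp add: triangular_step_def Let_def flip: x_def)
  then show ?thesis
    using assms by (simp add: Let_def flip: x_def) (auto simp: algebra_simps)
qed

section \<open>The row-wise order of the pivot pairs\<close>

definition lex_less :: "nat \<times> nat \<Rightarrow> nat \<times> nat \<Rightarrow> bool" where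
  "lex_less = (\<lambda>(a, b) (c, d). a < c \<or> a = c \<and> b < d)"

lemma set_rowwise_pairs: "set (rowwise_pairs n) = {(p, q). p < q \<and> q < n}"
  by (fastforce simp: rowwise_pairs_def)

lemma sorted_rowwise_pairs: "sorted_wrt lex_less (rowwise_pairs n)"
proof -
  \<comment> \<open>Only the number of rows is generalised to \<open>m\<close>; the column bound
    \<open>n\<close> stays fixed, so that the induction appends one row.\<close>
  have "sorted_wrt lex_less (concat (map (\<lambda>p. map (Pair p) [Suc p..<n]) [0..<m]))" for m
  proof (induction m)
    case (Suc m)
    then show ?case
      by (auto simp: sorted_wrt_append sorted_wrt_map lex_less_def)
  qed simp
  then show ?thesis by (simp add: rowwise_pairs_def)
qed

text \<open>Identifies the period in \<open>rowwise_pivots\<close> with the list length, so one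
  cycle runs through the list exactly once.\<close>

lemma length_rowwise_pairs: "length (rowwise_pairs n) = n * (n - 1) div 2"
proof -
  have "length (rowwise_pairs n) = (\<Sum>p<n. n - Suc p)"
    by (simp add: rowwise_pairs_def length_concat o_def sum_list_distinct_conv_sum_set
        atLeast0LessThan)
  also have "\<dots> = (\<Sum>p<n. p)" by (rule sum.nat_diff_reindex)
  also have "\<dots> = n * (n - 1) div 2"
    by (simp add: Sum_Ico_nat flip: atLeast0LessThan)
  finally show ?thesis .
qed

text \<open>Strict sortedness makes position and lexicographic order agree; membership in a prefix
  becomes inequalities between row and column indices.\<close>

lemma set_take_rowwise_pairs:
  assumes "k < length (rowwise_pairs n)"
  shows "set (take k (rowwise_pairs n))
    = {pq \<in> set (rowwise_pairs n). lex_less pq (rowwise_pairs n ! k)}"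
proof -
  let ?l = "rowwise_pairs n"
  have less: "lex_less (?l ! i) (?l ! j)" if "i < j" "j < length ?l" for i j
    using sorted_wrt_nth_less[OF sorted_rowwise_pairs] that by blast
  have "i < k" if "i < length ?l" "lex_less (?l ! i) (?l ! k)" for i
  proof (rule ccontr)
    assume "\<not> i < k"
    then have "i = k \<or> lex_less (?l ! k) (?l ! i)"
      using less[of k i] that(1) by linarith
    then show False using that(2) by (auto simp: lex_less_def split: prod.splits)
  qed
  then show ?thesis
    using assms less by (auto simp: in_set_conv_nth) (metis order.strict_trans nth_take)+
qed

text \<open>The invariant of the cycle after \<open>k\<close> steps, meant for the limit matrices
  and not for the perturbed ones.\<close>

definition annihilated :: "nat \<Rightarrow> complex mat \<Rightarrow> nat \<Rightarrow> complex mat \<Rightarrow> bool" where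
  "annihilated n B k A \<longleftrightarrow> A \<in> carrier_mat n n \<and> upper_triangular A \<and>
    (\<forall>i<n. A $$ (i,i) = B $$ (i,i)) \<and> (\<forall>pq \<in> set (take k (rowwise_pairs n)). A $$ pq = 0)"

text \<open>Only row \<open>p\<close> and column \<open>q\<close> change, by multiples of row
  \<open>q\<close> and column \<open>p\<close>. At positions already annihilated these multiples are
  themselves 0, so no fill-in occurs.\<close>

lemma annihilated_step:
  assumes A: "annihilated n B k A" and k: "k < length (rowwise_pairs n)"
    and B: "\<And>i j. i < j \<Longrightarrow> j < n \<Longrightarrow> B $$ (i,i) \<noteq> B $$ (j,j)"
  shows "annihilated n B (Suc k) (triangular_step n A (rowwise_pairs n ! k))"
proof -
  obtain p q where pq: "rowwise_pairs n ! k = (p, q)" by fastforce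
  then have "(p, q) \<in> set (rowwise_pairs n)" using k by (metis nth_mem)
  then have lt: "p < q" "q < n" "p < n" by (auto simp: set_rowwise_pairs)
  have C: "A \<in> carrier_mat n n" and diag: "\<And>i. i < n \<Longrightarrow> A $$ (i,i) = B $$ (i,i)"
    using A by (auto simp: annihilated_def)
  have lower: "A $$ (i,j) = 0" if "j < i" "i < n" for i j
    using A that by (auto simp: annihilated_def)
  have zero: "A $$ (i,j) = 0" if "i < j" "j < n" "i < p \<or> i = p \<and> j < q" for i j
    using A that set_take_rowwise_pairs[OF k]
    by (auto simp: annihilated_def pq set_rowwise_pairs lex_less_def)
  define x where "x = A $$ (p,q) / (A $$ (q,q) - A $$ (p,p))"
  have "A $$ (p,p) \<noteq> A $$ (q,q)" using B[OF lt(1,2)] lt by (simp add: diag)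
  \<comment> \<open>The left-hand side is the new entry at \<open>(p,q)\<close>.\<close>
  then have x: "A $$ (p,q) - x * A $$ (q,q) + x * A $$ (p,p) = 0"
    by (simp add: x_def field_simps)
  have entry: "triangular_step n A (p,q) $$ (i,j) =
      A $$ (i,j) - (if i = p then x * A $$ (q,j) else 0) + (if j = q then x * A $$ (i,p) else 0)"
    if "i < n" "j < n" for i j
    using index_triangular_step[OF C lt(3,2) _ that] lt lower by (simp add: Let_def x_def)
  have "upper_triangular (triangular_step n A (p,q))"
  proof (rule upper_triangularI)
    fix i j assume ij: "j < i" "i < dim_row (triangular_step n A (p,q))"
    then have "i < n" using triangular_step_carrier[OF C, of "(p,q)"] by simp
    then show "triangular_step n A (p,q) $$ (i,j) = 0"
      using ij(1) lt by (auto simp: entry lower)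
  qed
  moreover have "triangular_step n A (p,q) $$ (i,i) = B $$ (i,i)" if "i < n" for i
    using that lt by (auto simp: entry lower diag)
  moreover have "triangular_step n A (p,q) $$ (i,j) = 0"
    if "(i,j) \<in> set (take (Suc k) (rowwise_pairs n))" for i j
  proof -
    have "(i,j) = (p,q) \<or> (i,j) \<in> set (take k (rowwise_pairs n))"
      using that k by (auto simp: take_Suc_conv_app_nth pq)
    \<comment> \<open>The first case is the pivot. In the second, a change needs j = q and is x
      times the entry \<open>(i,p)\<close>, annihilated earlier with row \<open>i\<close>. In the
      third, it is x times the entry \<open>(q,j)\<close>, which lies below the diagonal.\<close>
    then consider "i = p" "j = q" | "i < j" "j < n" "i < p" | "i = p" "p < j" "j < q"
      by (auto simp: set_take_rowwise_pairs[OF k] pq set_rowwise_pairs lex_less_def)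
    then show ?thesis
      using lt x by cases (auto simp: entry lower zero)
  qed
  ultimately show ?thesis
    using triangular_step_carrier[OF C] by (auto simp: annihilated_def pq)
qed

text \<open>The invariant preserves the distinct diagonal of \<open>B\<close> and the zeros below
  it, so every pivot meets the hypotheses of \<open>jacobi_step_tendsto\<close>.\<close>

lemma naive_jacobi_tendsto:
  assumes sq: "\<And>k. sqrt_choice (sq k)"
    and X: "mat_tendsto n X B F" and B: "upper_triangular B"
    and distinct: "\<And>i j. i < j \<Longrightarrow> j < n \<Longrightarrow> B $$ (i,i) \<noteq> B $$ (j,j)"
    and "m \<le> length (rowwise_pairs n)"
  shows "\<exists>A. annihilated n B m A \<and>
    mat_tendsto n (\<lambda>k. naive_jacobi (sq k) (rowwise_pivots n) (X k) m) A F"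
  using assms(5)
proof (induction m)
  case 0
  then show ?case using X B by (auto simp: annihilated_def mat_tendsto_def)
next
  case (Suc m)
  then obtain A where A: "annihilated n B m A"
    and lim: "mat_tendsto n (\<lambda>k. naive_jacobi (sq k) (rowwise_pivots n) (X k) m) A F"
    by auto
  \<comment> \<open>Within the first cycle the reduction modulo the period has no effect.\<close>
  have piv: "rowwise_pivots n m = rowwise_pairs n ! m"
    using Suc.prems by (simp add: rowwise_pivots_def length_rowwise_pairs)
  obtain p q where pq: "rowwise_pairs n ! m = (p, q)" by fastforce
  then have "(p, q) \<in> set (rowwise_pairs n)" using Suc.prems by (metis Suc_le_lessD nth_mem)
  then have lt: "p < q" "q < n" by (auto simp: set_rowwise_pairs)
  have "mat_tendsto n (\<lambda>k. naive_jacobi (sq k) (rowwise_pivots n) (X k) (Suc m))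
      (triangular_step n A (p,q)) F"
    unfolding naive_jacobi.simps piv pq
    using A distinct[OF lt] lt
    by (intro jacobi_step_tendsto[OF sq lim]) (auto simp: annihilated_def)
  then show ?case
    using annihilated_step[OF A _ distinct] Suc.prems pq by auto
qed

section \<open>Simple eigenvalues and the final estimate\<close>

text \<open>The characteristic polynomial is the product of the linear factors of the diagonal, so a
  repeated entry would be a root of order at least 2.\<close>

lemma simple_eigenvalues_diag_distinct:
  assumes A: "A \<in> carrier_mat n n" "upper_triangular A" and simple: "simple_eigenvalues A"
    and ij: "i < j" "j < n"
  shows "A $$ (i,i) \<noteq> A $$ (j,j)"
proof
  assume eq: "A $$ (i,i) = A $$ (j,j)"
  define e where "e = A $$ (i,i)"
  let ?f = "\<lambda>k. [:- A $$ (k,k), 1:]"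
  have "char_poly A = (\<Prod>k<n. ?f k)"
    using A by (simp add: char_poly_upper_triangular[OF A] diag_mat_def o_def
        prod.distinct_set_conv_list[symmetric] atLeast0LessThan)
  moreover have "(\<Prod>k\<in>{i,j}. ?f k) dvd (\<Prod>k<n. ?f k)"
    using ij by (intro prod_dvd_prod_subset) auto
  moreover have "(\<Prod>k\<in>{i,j}. ?f k) = [:- e, 1:] ^ 2"
    using ij eq by (simp add: e_def power2_eq_square)
  ultimately have dvd: "[:- e, 1:] ^ 2 dvd char_poly A" by simp
  then have "[:- e, 1:] dvd char_poly A"
    by (metis dvd_power dvd_trans zero_less_numeral)
  then have "eigenvalue A e"
    by (simp add: eigenvalue_root_char_poly[OF A(1)] poly_eq_0_iff_dvd)
  then have "Polynomial.order e (char_poly A) = 1"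
    using simple by (simp add: simple_eigenvalues_def)
  \<comment> \<open>\<open>order_divides\<close> bounds the order only for a nonzero
    polynomial.\<close>
  moreover have "char_poly A \<noteq> 0"
    using degree_monic_char_poly[OF A(1)] by auto
  ultimately show False using dvd by (simp add: order_divides)
qed

section \<open>Estimates for the off-diagonal maximum and the diagonal gap\<close>

lemma offdiag_max_le:
  assumes "A \<in> carrier_mat n n" "n \<ge> 2"
    and "\<And>i j. i < n \<Longrightarrow> j < n \<Longrightarrow> i \<noteq> j \<Longrightarrow> cmod (A $$ (i,j)) \<le> e"
  shows "offdiag_max A \<le> e"
proof -
  let ?I = "{(i,j). i < n \<and> j < n \<and> i \<noteq> j}"
  have fin: "finite ?I" by (rule finite_subset[of _ "{..<n} \<times> {..<n}"]) auto
  have "{cmod (A $$ (i,j)) | i j. i < dim_row A \<and> j < dim_row A \<and> i \<noteq> j}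
      = (\<lambda>ij. cmod (A $$ ij)) ` ?I"
    using assms(1) by auto
  moreover have "(0, 1) \<in> ?I" using assms(2) by simp
  then have "?I \<noteq> {}" by blast
  ultimately show ?thesis
    unfolding offdiag_max_def using assms(3) fin by auto
qed

lemma diag_gap_gt:
  assumes "A \<in> carrier_mat n n" "n \<ge> 2"
    and "\<And>i j. i < j \<Longrightarrow> j < n \<Longrightarrow> cmod (A $$ (i,i) - A $$ (j,j)) > m"
  shows "diag_gap A > m"
proof -
  let ?I = "{(i,j). i < n \<and> j < n \<and> i \<noteq> j}"
  have fin: "finite ?I" by (rule finite_subset[of _ "{..<n} \<times> {..<n}"]) auto
  have "{cmod (A $$ (i,i) - A $$ (j,j)) | i j. i < dim_row A \<and> j < dim_row A \<and> i \<noteq> j}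
      = (\<lambda>(i,j). cmod (A $$ (i,i) - A $$ (j,j))) ` ?I"
    using assms(1) by auto
  moreover have "(0, 1) \<in> ?I" using assms(2) by simp
  then have "?I \<noteq> {}" by blast
  moreover have "cmod (A $$ (i,i) - A $$ (j,j)) > m" if "i < n" "j < n" "i \<noteq> j" for i j
    using that assms(3)[of i j] assms(3)[of j i] by (auto simp: norm_minus_commute neq_iff)
  ultimately show ?thesis
    unfolding diag_gap_def using fin by auto
qed

lemma norm_le_lower_max:
  assumes "A \<in> carrier_mat n n" "j < i" "i < n"
  shows "cmod (A $$ (i,j)) \<le> lower_max A"
proof -
  have "{cmod (A $$ (i,j)) | i j. i < dim_row A \<and> j < i}
      = (\<lambda>(i,j). cmod (A $$ (i,j))) ` (SIGMA i:{..<n}. {..<i})"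
    using assms(1) by auto
  then show ?thesis
    unfolding lower_max_def using assms(2,3) by (auto intro!: Max_ge)
qed

text \<open>Since \<open>\<mu>\<^sub>N\<close> is bounded below by half the smallest gap of the limit, it suffices
  that the off-diagonal entries are at most \<open>1 / (160 (n - 1))\<close> times the latter.\<close>

lemma eventually_gap_dominates:
  assumes X: "mat_tendsto n X D F" and n: "n \<ge> 2"
    and gap: "\<And>i j. i < j \<Longrightarrow> j < n \<Longrightarrow> D $$ (i,i) \<noteq> D $$ (j,j)"
    and offdiag: "\<And>i j. i < n \<Longrightarrow> j < n \<Longrightarrow> i \<noteq> j \<Longrightarrow> D $$ (i,j) = 0"
  shows "eventually (\<lambda>k. diag_gap (X k) > 0 \<and>
    80 * (real n - 1) * (offdiag_max (X k) / diag_gap (X k)) \<le> 1) F"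
proof -
  have C: "X k \<in> carrier_mat n n" "D \<in> carrier_mat n n" for k
    using X by (auto simp: mat_tendsto_def)
  have lim: "((\<lambda>k. X k $$ (i,j)) \<longlongrightarrow> D $$ (i,j)) F" if "i < n" "j < n" for i j
    using X that by (auto simp: mat_tendsto_def)
  \<comment> \<open>Halving leaves room for a strict inequality that persists near the
    limit.\<close>
  define \<mu> where "\<mu> = diag_gap D / 2"
  have "diag_gap D > 0" using gap by (intro diag_gap_gt[OF C(2) n]) simp
  then have \<mu>: "\<mu> > 0" by (simp add: \<mu>_def)
  have D\<mu>: "cmod (D $$ (i,i) - D $$ (j,j)) > \<mu>" if "i < j" "j < n" for i j
  proof -
    let ?S = "{cmod (D $$ (i,i) - D $$ (j,j)) | i j. i < dim_row D \<and> j < dim_row D \<and> i \<noteq> j}"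
    have "?S = (\<lambda>(i,j). cmod (D $$ (i,i) - D $$ (j,j)))
        ` ({..<n} \<times> {..<n} - {(i,j). i = j})"
      using C(2) by auto
    then have "finite ?S" by simp
    moreover have "cmod (D $$ (i,i) - D $$ (j,j)) \<in> ?S" using that C(2) by force
    ultimately have "diag_gap D \<le> cmod (D $$ (i,i) - D $$ (j,j))"
      unfolding diag_gap_def by (rule Min_le)
    then show ?thesis using \<mu> by (simp add: \<mu>_def)
  qed
  \<comment> \<open>Chosen so that 80 (n - 1) e = \<mu>.\<close>
  define e where "e = \<mu> / (80 * (real n - 1))"
  have e: "e > 0" using \<mu> n by (simp add: e_def)
  have "eventually (\<lambda>k. \<forall>i\<in>{..<n}. \<forall>j\<in>{..<n}.
      (i < j \<longrightarrow> cmod (X k $$ (i,i) - X k $$ (j,j)) > \<mu>) \<and>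
      (i \<noteq> j \<longrightarrow> cmod (X k $$ (i,j)) < e)) F"
  proof (intro eventually_ball_finite ballI finite_lessThan eventually_conj)
    fix i j assume "i \<in> {..<n}" "j \<in> {..<n}"
    then have ij: "i < n" "j < n" by auto
    have "((\<lambda>k. cmod (X k $$ (i,i) - X k $$ (j,j)))
        \<longlongrightarrow> cmod (D $$ (i,i) - D $$ (j,j))) F"
      by (intro tendsto_intros lim ij)
    from order_tendstoD(1)[OF this, of \<mu>]
    show "eventually (\<lambda>k. i < j \<longrightarrow> cmod (X k $$ (i,i) - X k $$ (j,j)) > \<mu>) F"
      using D\<mu> ij by (cases "i < j") auto
    from order_tendstoD(2)[OF tendsto_norm[OF lim[OF ij]], of e]
    show "eventually (\<lambda>k. i \<noteq> j \<longrightarrow> cmod (X k $$ (i,j)) < e) F"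
      using offdiag[OF ij] e by (cases "i = j") auto
  qed
  then show ?thesis
  proof eventually_elim
    case (elim k)
    have gap_k: "diag_gap (X k) > \<mu>"
      using elim by (intro diag_gap_gt[OF C(1) n]) auto
    have "offdiag_max (X k) \<le> e"
      using elim by (intro offdiag_max_le[OF C(1) n]) (simp add: less_imp_le)
    then have "80 * (real n - 1) * offdiag_max (X k) \<le> \<mu>"
      using n by (simp add: e_def field_simps)
    then show ?case using gap_k \<mu> by (simp add: field_simps)
  qed
qed

theorem theorem3p9:
  fixes n :: nat and B :: "complex mat"
  assumes "n \<ge> 3"
    and "B \<in> carrier_mat n n"
    and "upper_triangular B"
    and "simple_eigenvalues B"
  shows "\<exists>c > 0. \<forall>sq L. sqrt_choice sq \<longrightarrow> L \<in> carrier_mat n n \<longrightarrow> strictly_lower_triangular L \<longrightarrow>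
    (let A = B + L;
         A\<^sub>N = naive_jacobi sq (rowwise_pivots n) A (n * (n - 1) div 2)
     in lower_max A < c \<longrightarrow>
          diag_gap A\<^sub>N > 0 \<and> 80 * (real n - 1) * (offdiag_max A\<^sub>N / diag_gap A\<^sub>N) \<le> 1)"
proof (rule ccontr)
  let ?N = "n * (n - 1) div 2"
  let ?good = "\<lambda>M. diag_gap M > 0 \<and> 80 * (real n - 1) * (offdiag_max M / diag_gap M) \<le> 1"
  let ?bad = "\<lambda>c sq L. sqrt_choice sq \<and> L \<in> carrier_mat n n \<and> strictly_lower_triangular L \<and>
      lower_max (B + L) < c \<and> \<not> ?good (naive_jacobi sq (rowwise_pivots n) (B + L) ?N)"
  assume "\<not> ?thesis"
  then have "\<exists>sq L. ?bad c sq L" if "c > 0" for c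
    using that unfolding Let_def by blast
  \<comment> \<open>If no \<open>c\<close> works, the values 1/(k+1) yield a sequence of
    counterexamples, each with its own root. This makes \<open>c\<close> independent of root and
    perturbation.\<close>
  then have "\<forall>k. \<exists>sq L. ?bad (inverse (real (Suc k))) sq L" by simp
  then obtain sq L where bad: "\<And>k. ?bad (inverse (real (Suc k))) (sq k) (L k)"
    by metis
  have sq: "sqrt_choice (sq k)" and L: "L k \<in> carrier_mat n n"
    and lower: "strictly_lower_triangular (L k)"
    and small: "lower_max (B + L k) < inverse (real (Suc k))"
    and not_good: "\<not> ?good (naive_jacobi (sq k) (rowwise_pivots n) (B + L k) ?N)" for k
    using bad[of k] by blast+
  have distinct: "B $$ (i,i) \<noteq> B $$ (j,j)" if "i < j" "j < n" for i j
    using simple_eigenvalues_diag_distinct[OF assms(2-4) that] .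
  have "(\<lambda>k. (B + L k) $$ (i,j)) \<longlonglongrightarrow> B $$ (i,j)" if ij: "i < n" "j < n" for i j
  proof (cases "j < i")
    case True
    have "norm ((B + L k) $$ (i,j)) \<le> inverse (real (Suc k))" for k
      using norm_le_lower_max[OF add_carrier_mat[OF L] True ij(1), of B k] small[of k] by linarith
    then have "(\<lambda>k. (B + L k) $$ (i,j)) \<longlonglongrightarrow> 0"
      by (intro tendsto_0_le[OF LIMSEQ_inverse_real_of_nat, where K = 1] always_eventually) simp
    \<comment> \<open>Below the diagonal \<open>B\<close> vanishes, so 0 is the required
      limit.\<close>
    then show ?thesis using upper_triangularD[OF assms(3) True] assms(2) ij by simp
  next
    case False
    have "(B + L k) $$ (i,j) = B $$ (i,j)" for k
      using lower[of k] L[of k] False ij by (simp add: strictly_lower_triangular_def)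
    then show ?thesis by simp
  qed
  then have X: "mat_tendsto n (\<lambda>k. B + L k) B sequentially"
    using add_carrier_mat[OF L] assms(2) by (simp add: mat_tendsto_def)
  have "\<exists>D. annihilated n B ?N D \<and>
    mat_tendsto n (\<lambda>k. naive_jacobi (sq k) (rowwise_pivots n) (B + L k) ?N) D sequentially"
    by (rule naive_jacobi_tendsto[OF sq X assms(3) distinct]) (simp_all add: length_rowwise_pairs)
  then obtain D where D: "annihilated n B ?N D" and lim:
    "mat_tendsto n (\<lambda>k. naive_jacobi (sq k) (rowwise_pivots n) (B + L k) ?N) D sequentially"
    by (elim exE conjE)
  \<comment> \<open>After the full cycle the prefix is the whole list, which clears the part above
    the diagonal; triangularity clears the part below.\<close>
  have "D $$ (i,j) = 0" if "i < n" "j < n" "i \<noteq> j" for i j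
  proof (cases "i < j")
    case True
    then show ?thesis
      using D that unfolding annihilated_def length_rowwise_pairs[symmetric]
      by (auto simp: set_rowwise_pairs)
  next
    case False
    then show ?thesis using D that by (auto simp: annihilated_def)
  qed
  moreover have "D $$ (i,i) \<noteq> D $$ (j,j)" if "i < j" "j < n" for i j
    using D distinct[OF that] that by (simp add: annihilated_def)
  ultimately have "eventually
      (\<lambda>k. ?good (naive_jacobi (sq k) (rowwise_pivots n) (B + L k) ?N)) sequentially"
    using assms(1) by (intro eventually_gap_dominates[OF lim]) auto
  then have "\<exists>k. ?good (naive_jacobi (sq k) (rowwise_pivots n) (B + L k) ?N)"
    by (rule eventually_happens'[OF sequentially_bot])
  then show False using not_good by blast
qed

end
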